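(* Let $\{r_t\}_{t\in\mathbb{N}}$ be an i.i.d. sequence of $D$-valued random variables with $D\subseteq\mathbb{R}^p$. Let $f:\mathbb{R}^m\times\mathbb{R}^n\times\mathbb{R}^p\to\mathbb{R}^m$, let $z_{\mathrm{ss}}:\mathbb{R}^n\to\mathbb{R}^m$ satisfy $z_{\mathrm{ss}}(u)=f(z_{\mathrm{ss}}(u),u,r)$ for all $u\in\mathbb{R}^n$ and $r\in D$, let $\ell:\mathbb{R}^m\to\mathbb{R}$ be a cost function, and consider the closed-loop system $$u_{t+1}=u_t-\delta\gamma\nabla z_{\mathrm{ss}}(u_t)\nabla\ell(z_t),\qquad z_{t+1}=f(z_t,u_t,r_t),\qquad t\in\mathbb{N},$$ with $\gamma,\delta>0$. (i) Assume that $\ell(z_{\mathrm{ss}}(\cdot))$ is differentiable, $s$-strongly convex, and has an $L$-Lipschitz continuous gradient for some $s,L>0$. Assume that $z_{\mathrm{ss}}$ is differentiable and that there is $c_F\in(0,1)$ such that $$\mathbb{E}[d(f(z,u,r_t),z_{\mathrm{ss}}(u))]\le c_F\,d(z,z_{\mathrm{ss}}(u))$$ for all $(z,u)\in\mathbb{R}^m\times\mathbb{R}^n$ and $t\in\mathbb{N}$. Let $\nabla\ell$ and $z_{\mathrm{ss}}$ be $L_\ell$- and $L_{\mathrm{FIX}}$-Lipschitz continuous for some $L_\ell,L_{\mathrm{FIX}}>0$, respectively. Let $$\bar\delta:=\frac{\left(1-\sqrt{1-2\gamma sL/(s+L)}\right)(1-c_F)}{\gamma L_{\mathrm{FIX}}^2L_\ell\left(\left(1-\sqrt{1-2\gamma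 sL/(s+L)}\right)+\gamma L\right)}.$$ Then, for all $\gamma\in(0,2/(s+L)]$ and $\delta\in(0,\min\{\bar\delta,1\})$, there exist $C>0$ and $\rho\in(0,1)$ such that the trajectories satisfy $$\left\|\begin{bmatrix}\mathbb{E}[d(u_t,u_\star)]\\ \mathbb{E}[d(z_t,z_{\mathrm{ss}}(u_t))]\end{bmatrix}\right\|\le C\rho^t\left\|\begin{bmatrix}d(u_0,u_\star)\\ d(z_0,z_{\mathrm{ss}}(u_0))\end{bmatrix}\right\|$$ for all (deterministic) $(u_0,z_0)\in\mathbb{R}^n\times\mathbb{R}^m$ and $t\in\mathbb{N}$, where $u_\star\in\mathbb{R}^n$ is the unique minimizer of $\ell(z_{\mathrm{ss}}(\cdot))$. (ii) Suppose that all the assumptions of (i) hold, except that, instead of being strongly convex, $\ell(z_{\mathrm{ss}}(\cdot))$ is only convex and satisfies the quadratic growth condition $$\ell(z_{\mathrm{ss}}(u))-\ell_\star\ge\frac s2\,d(u,U_\star)^2\qquad\text{for all }u\in\mathbb{R}^n,$$ for some $s>0$, where $U_\star$ is the set of minimizers of $\ell(z_{\mathrm{ss}}(\cdot))$ and $\ell_\star$ is its minimum value. Let $$\bar\delta:=\frac{\left(1-\sqrt{1-\frac{\gamma s^2(2-\gamma L)}{4L}}\right)(1-c_F)}{\gamma L_{\mathrm{FIX}}^2L_\ell\left(\left(1-\sqrt{1-\frac{\gamma s^2(2-\gamma L)}{4L}}\right)+\gamma L\right)}.$$ Then, for all $\gamma\in(0,2/L)$ and $\delta\in(0,\min\{\bar\delta,1\})$,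 there exist $C>0$ and $\rho\in(0,1)$ such that the trajectories satisfy $$\left\|\begin{bmatrix}\mathbb{E}[d(u_t,U_\star)]\\ \mathbb{E}[d(z_t,z_{\mathrm{ss}}(u_t))]\end{bmatrix}\right\|\le C\rho^t\left\|\begin{bmatrix}d(u_0,U_\star)\\ d(z_0,z_{\mathrm{ss}}(u_0))\end{bmatrix}\right\|$$ for all (deterministic) $(u_0,z_0)\in\mathbb{R}^n\times\mathbb{R}^m$ and $t\in\mathbb{N}$.
   Context: $\|\cdot\|$ and $d(\cdot,\cdot)$ are the Euclidean norm and distance; $d(u,U_\star)=\inf_{y\in U_\star}d(u,y)$. $\nabla z_{\mathrm{ss}}(u)\in\mathbb{R}^{n\times m}$ denotes the transpose of the Jacobian of $z_{\mathrm{ss}}$ at $u$, so that $\nabla z_{\mathrm{ss}}(u)\nabla\ell(z_{\mathrm{ss}}(u))$ is the gradient of $u\mapsto\ell(z_{\mathrm{ss}}(u))$. $\ell$ is differentiable. In (ii) the minimum of $\ell(z_{\mathrm{ss}}(\cdot))$ is attained (i.e. $U_\star\neq\emptyset$). The random variables $r_t$ live on a complete probability space, and $f$ is understood to be Borel measurable, so that the expectations are meaningful. The constants $C,\rho$ do not depend on the initial condition or on $t$. *)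

theory Defs
  imports "HOL-Probability.Probability"
begin

definition gradient :: "('a::real_inner \<Rightarrow> real) \<Rightarrow> 'a \<Rightarrow> 'a" where
  "gradient g x = (THE D. GDERIV g x :> D)"

definition strongly_convex :: "real \<Rightarrow> ('a::real_inner \<Rightarrow> real) \<Rightarrow> bool" where
  "strongly_convex s g \<longleftrightarrow>
     (\<forall>x y. \<forall>a\<in>{0..1}.
        g (a *\<^sub>R x + (1 - a) *\<^sub>R y)
          \<le> a * g x + (1 - a) * g y - s / 2 * a * (1 - a) * (norm (x - y))\<^sup>2)"

definition minimizers :: "('a \<Rightarrow> real) \<Rightarrow> 'a set" where
  "minimizers g = {x. \<forall>y. g x \<le> g y}"

definition closed_loop ::
  "'w measure \<Rightarrow> (real^'m \<Rightarrow> real^'n \<Rightarrow> real^'p \<Rightarrow> real^'m) \<Rightarrow> (real^'n \<Rightarrow> real^'m) \<Rightarrow> (real^'m \<Rightarrow> real)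
    \<Rightarrow> (nat \<Rightarrow> 'w \<Rightarrow> real^'p) \<Rightarrow> real \<Rightarrow> real \<Rightarrow> real^'n \<Rightarrow> real^'m
    \<Rightarrow> (nat \<Rightarrow> 'w \<Rightarrow> real^'n) \<Rightarrow> (nat \<Rightarrow> 'w \<Rightarrow> real^'m) \<Rightarrow> bool" where
  "closed_loop M f z_ss l r \<gamma> \<delta> u0 z0 u z \<longleftrightarrow>
     (\<forall>\<omega>\<in>space M.
        u 0 \<omega> = u0 \<and> z 0 \<omega> = z0 \<and>
        (\<forall>t. u (Suc t) \<omega> =
                u t \<omega> - (\<delta> * \<gamma>) *\<^sub>R (transpose (jacobian z_ss (at (u t \<omega>))) *v gradient l (z t \<omega>)) \<and>
             z (Suc t) \<omega> = f (z t \<omega>) (u t \<omega>) (r t \<omega>)))"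

(* The threshold for delta, where q is the contraction factor of the gradient step
   u - gamma * grad (l o z_ss) u towards the minimizers. *)
definition delta_bar :: "real \<Rightarrow> real \<Rightarrow> real \<Rightarrow> real \<Rightarrow> real \<Rightarrow> real \<Rightarrow> real" where
  "delta_bar q \<gamma> c_F L_FIX L_l L =
     ((1 - q) * (1 - c_F)) / (\<gamma> * L_FIX\<^sup>2 * L_l * ((1 - q) + \<gamma> * L))"

end

theory Submission
  imports Defs
begin

text \<open>The plant contracts towards its steady state on a fast time scale while the controller performs a
gradient step with the small relaxation \<open>\<delta>\<close>. Let \<open>\<Phi> u = l (z_ss u)\<close>, let \<open>e\<close> be the distance of the input
\<open>u\<close> to the minimizers of \<open>\<Phi>\<close>, and let \<open>w\<close> be the distance of the plant state \<open>z\<close> to \<open>z_ss u\<close>. Everything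
reduces to a pair of coupled linear inequalities for the expectations of \<open>e\<close> and \<open>w\<close>.

For \<open>e\<close>: by the chain rule the controller would move along \<open>gradient \<Phi> u\<close> if the plant were at
\<open>z_ss u\<close>, and replacing \<open>z_ss u\<close> by \<open>z\<close> changes the direction by at most \<open>L_FIX * L_l * w\<close>. The new input is a
convex combination, with weights \<open>1 - \<delta>\<close> and \<open>\<delta>\<close>, of the old input and an exact gradient step, up to this
error. If an exact step contracts the distance to the minimizers by \<open>q\<close>, the new distance is at most
\<open>(1 - \<delta> * (1 - q)) * e + \<delta> * \<gamma> * L_FIX * L_l * w\<close>.

For \<open>w\<close>: the plant contracts by \<open>c_F\<close> in the mean, because the state and input at time \<open>t\<close> are
functions of \<open>r 0, \<dots>, r (t - 1)\<close> and hence independent of \<open>r t\<close>, so that the contraction for fixed \<open>(z, u)\<close>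
can be integrated against their distribution. Then the target \<open>z_ss u\<close> moves by at most \<open>L_FIX\<close> times the
length of the input step, which is at most \<open>\<delta> * \<gamma> * (L * e + L_FIX * L_l * w)\<close>.

The resulting 2-by-2 system for nonnegative quantities decays geometrically if its off-diagonal product is smaller than
the product of the (positive) diagonal gaps to 1, and solving this condition for \<open>\<delta>\<close> gives exactly
\<open>\<delta> < delta_bar q \<gamma> c_F L_FIX L_l L\<close>.

It remains to find \<open>q\<close>. Both parts rest on the inequality
\<open>s * L * \<parallel>x - y\<parallel>\<^sup>2 + \<parallel>\<nabla>\<Phi> x - \<nabla>\<Phi> y\<parallel>\<^sup>2 \<le> (s + L) * \<langle>\<nabla>\<Phi> x - \<nabla>\<Phi> y, x - y\<rangle>\<close> for \<open>s\<close>-strongly convex functions with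
\<open>L\<close>-Lipschitz gradient (\<open>gradient_coercive\<close>), with \<open>y\<close> a minimizer. Under strong convexity it yields the
factor at once. In the merely convex case it is used with \<open>s = 0\<close>, which only gives a decrease
proportional to \<open>\<parallel>\<nabla>\<Phi> x\<parallel>\<^sup>2\<close>; quadratic growth together with convexity forces \<open>\<parallel>\<nabla>\<Phi> x\<parallel> \<ge> s / 2 * e\<close>.\<close>

section \<open>Gradients and Jacobians\<close>

text \<open>The Riesz representative of the derivative is the adjoint of the
derivative applied to \<open>1\<close>; uniqueness makes the definite description in \<open>gradient\<close> denote it.\<close>

lemma differentiable_imp_GDERIV_gradient:
  fixes g :: "'a::euclidean_space \<Rightarrow> real"
  assumes "g differentiable (at x)"
  shows "GDERIV g x :> gradient g x"
proof -
  obtain g' where g': "(g has_derivative g') (at x)"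
    using assms by (auto simp: differentiable_def)
  interpret bounded_linear g'
    using g' by (rule has_derivative_bounded_linear)
  have "g' = (\<lambda>h. inner h (adjoint g' 1))"
    using adjoint_works[OF linear_axioms, of _ 1] by (simp add: fun_eq_iff)
  then have D: "GDERIV g x :> adjoint g' 1"
    using g' by (simp add: gderiv_def)
  have "D = D'" if "GDERIV g x :> D" "GDERIV g x :> D'" for D D' :: 'a
  proof -
    have "(\<lambda>h. inner h D) = (\<lambda>h. inner h D')"
      using that unfolding gderiv_def by (rule has_derivative_unique)
    then show ?thesis
      by (metis inner_commute vector_eq_ldot)
  qed
  with D show ?thesis
    unfolding gradient_def by (metis (no_types, lifting) theI)
qed

text \<open>A derivative is a limit of difference quotients along a
\<^emph>\<open>sequence\<close>. This form transports Lipschitz bounds, convexity inequalities and Borel measurability from a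
function to its derivative.\<close>

lemma has_derivative_directional_LIMSEQ:
  fixes g :: "'a::real_normed_vector \<Rightarrow> 'b::real_normed_vector"
  assumes "(g has_derivative g') (at x)"
  shows "(\<lambda>n. real (Suc n) *\<^sub>R (g (x + inverse (real (Suc n)) *\<^sub>R h) - g x)) \<longlonglongrightarrow> g' h"
proof -
  interpret bounded_linear g'
    using assms by (rule has_derivative_bounded_linear)
  define a where "a n = inverse (real (Suc n))" for n
  have a: "a n > 0" for n
    by (simp add: a_def)
  show ?thesis
  proof (cases "h = 0")
    case False
    have "filterlim (\<lambda>n. a n *\<^sub>R h) (at 0) sequentially"
      using tendsto_scaleR[OF LIMSEQ_inverse_real_of_nat tendsto_const[of h]] a False
      by (auto simp: filterlim_at a_def)
    moreover have "((\<lambda>h. norm (g (x + h) - g x - g' h) / norm h) \<longlongrightarrow> 0) (at 0)"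
      using assms by (simp add: has_derivative_at)
    ultimately have "(\<lambda>n. norm (g (x + a n *\<^sub>R h) - g x - g' (a n *\<^sub>R h)) / norm (a n *\<^sub>R h)) \<longlonglongrightarrow> 0"
      by (rule filterlim_compose[rotated])
    from tendsto_mult_right[OF this, of "norm h"]
    have "(\<lambda>n. norm (g (x + a n *\<^sub>R h) - g x - g' (a n *\<^sub>R h)) / norm (a n *\<^sub>R h) * norm h) \<longlonglongrightarrow> 0"
      by simp
    also have "(\<lambda>n. norm (g (x + a n *\<^sub>R h) - g x - g' (a n *\<^sub>R h)) / norm (a n *\<^sub>R h) * norm h)
        = (\<lambda>n. norm (real (Suc n) *\<^sub>R (g (x + a n *\<^sub>R h) - g x) - g' h))"
    proof
      fix n
      have "real (Suc n) *\<^sub>R (g (x + a n *\<^sub>R h) - g x) - g' h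
          = real (Suc n) *\<^sub>R (g (x + a n *\<^sub>R h) - g x - g' (a n *\<^sub>R h))"
        by (simp add: scaleR scaleR_right_diff_distrib a_def del: of_nat_Suc)
      then show "norm (g (x + a n *\<^sub>R h) - g x - g' (a n *\<^sub>R h)) / norm (a n *\<^sub>R h) * norm h
          = norm (real (Suc n) *\<^sub>R (g (x + a n *\<^sub>R h) - g x) - g' h)"
        using False by (simp add: a_def divide_simps del: of_nat_Suc)
    qed
    finally show ?thesis
      unfolding a_def by (subst (asm) tendsto_norm_zero_iff) (simp add: LIM_zero_iff del: of_nat_Suc)
  qed (simp add: zero)
qed

lemma lipschitz_on_imp_derivative_bound:
  fixes g :: "'a::real_normed_vector \<Rightarrow> 'b::real_normed_vector"
  assumes "(g has_derivative g') (at x)" and lip: "B-lipschitz_on UNIV g"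
  shows "norm (g' h) \<le> B * norm h"
proof (rule Lim_bounded[where M=0])
  show "(\<lambda>n. norm (real (Suc n) *\<^sub>R (g (x + inverse (real (Suc n)) *\<^sub>R h) - g x))) \<longlonglongrightarrow> norm (g' h)"
    using assms(1) by (intro tendsto_norm has_derivative_directional_LIMSEQ)
  show "\<forall>n\<ge>0. norm (real (Suc n) *\<^sub>R (g (x + inverse (real (Suc n)) *\<^sub>R h) - g x)) \<le> B * norm h"
  proof (intro allI impI)
    fix n
    have "norm (g (x + inverse (real (Suc n)) *\<^sub>R h) - g x) \<le> B * (inverse (real (Suc n)) * norm h)"
      using lipschitz_onD[OF lip, of "x + inverse (real (Suc n)) *\<^sub>R h" x] by (simp add: dist_norm)
    then have "real (Suc n) * norm (g (x + inverse (real (Suc n)) *\<^sub>R h) - g x)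
        \<le> real (Suc n) * (B * (inverse (real (Suc n)) * norm h))"
      by (intro mult_left_mono) auto
    also have "\<dots> = B * norm h"
      by (simp add: field_simps)
    finally show "norm (real (Suc n) *\<^sub>R (g (x + inverse (real (Suc n)) *\<^sub>R h) - g x)) \<le> B * norm h"
      by simp
  qed
qed

lemma inner_transpose_matrix_vector:
  fixes A :: "real^'n^'m"
  shows "inner (transpose A *v v) h = inner v (A *v h)"
  using dot_lmul_matrix[of v A h] by simp

lemma norm_transpose_jacobian_le:
  fixes g :: "real^'n \<Rightarrow> real^'m"
  assumes "g differentiable (at x)" and "B-lipschitz_on UNIV g"
  shows "norm (transpose (jacobian g (at x)) *v v) \<le> B * norm v"
proof -
  let ?w = "transpose (jacobian g (at x)) *v v"
  have "(norm ?w)\<^sup>2 = inner v (jacobian g (at x) *v ?w)"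
    by (simp add: power2_norm_eq_inner inner_transpose_matrix_vector del: transpose_matrix_vector)
  also have "\<dots> \<le> norm v * norm (jacobian g (at x) *v ?w)"
    by (rule norm_cauchy_schwarz)
  also have "\<dots> \<le> norm v * (B * norm ?w)"
    using assms jacobian_works by (intro mult_left_mono lipschitz_on_imp_derivative_bound[of g _ x]) auto
  finally have "norm ?w * norm ?w \<le> (B * norm v) * norm ?w"
    by (simp add: power2_eq_square mult_ac)
  then show ?thesis
    using lipschitz_on_nonneg[OF assms(2)] by (cases "?w = 0") (auto simp del: transpose_matrix_vector)
qed

lemma gradient_compose_jacobian:
  fixes g :: "real^'n \<Rightarrow> real^'m" and k :: "real^'m \<Rightarrow> real"
  assumes g: "g differentiable (at x)" and k: "k differentiable (at (g x))"
  shows "gradient (\<lambda>x. k (g x)) x = transpose (jacobian g (at x)) *v gradient k (g x)"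
proof -
  have 1: "(g has_derivative (\<lambda>h. jacobian g (at x) *v h)) (at x)"
    using g jacobian_works by blast
  have 2: "(k has_derivative (\<lambda>h. inner h (gradient k (g x)))) (at (g x))"
    using differentiable_imp_GDERIV_gradient[OF k] by (simp add: gderiv_def)
  have 3: "((\<lambda>x. k (g x)) has_derivative (\<lambda>h. inner (jacobian g (at x) *v h) (gradient k (g x)))) (at x)"
    using has_derivative_compose[OF 1 2] .
  then have "(\<lambda>x. k (g x)) differentiable (at x)"
    by (auto simp: differentiable_def)
  from differentiable_imp_GDERIV_gradient[OF this]
  have "(\<lambda>h. inner h (gradient (\<lambda>x. k (g x)) x)) = (\<lambda>h. inner (jacobian g (at x) *v h) (gradient k (g x)))"
    unfolding gderiv_def using 3 by (rule has_derivative_unique)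
  also have "\<dots> = (\<lambda>h. inner h (transpose (jacobian g (at x)) *v gradient k (g x)))"
    by (metis inner_commute inner_transpose_matrix_vector)
  finally show ?thesis
    by (metis inner_commute vector_eq_ldot)
qed

text \<open>The Jacobian of a function that is merely differentiable need not be
continuous, but it is a pointwise limit of continuous difference quotients, hence Borel measurable. This
makes the input of the closed loop a random variable.\<close>

lemma borel_measurable_transpose_jacobian:
  fixes g :: "real^'n \<Rightarrow> real^'m"
  assumes g: "\<And>x. g differentiable (at x)"
  shows "(\<lambda>(x, v). transpose (jacobian g (at x)) *v v) \<in> borel_measurable (borel \<Otimes>\<^sub>M borel)"
proof -
  have "continuous_on UNIV g"
    using g by (simp add: continuous_on_eq_continuous_at differentiable_imp_continuous_within)
  then have [measurable]: "g \<in> borel_measurable borel"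
    by (rule borel_measurable_continuous_onI)
  have [measurable]: "(\<lambda>x. jacobian g (at x) *v h) \<in> borel_measurable borel" for h
  proof (rule borel_measurable_LIMSEQ_metric)
    show "(\<lambda>n. real (Suc n) *\<^sub>R (g (x + inverse (real (Suc n)) *\<^sub>R h) - g x)) \<longlonglongrightarrow> jacobian g (at x) *v h" for x
      using g jacobian_works by (intro has_derivative_directional_LIMSEQ) auto
  qed simp
  \<comment> \<open>Moving the transpose across the inner product separates the two arguments.\<close>
  show ?thesis
    by (simp add: borel_measurable_euclidean_space[of "\<lambda>(x, v). transpose (jacobian g (at x)) *v v"]
        split_beta inner_transpose_matrix_vector del: transpose_matrix_vector)
qed

section \<open>Gradient steps on smooth convex functions\<close>

text \<open>Along the segment from \<open>x\<close> to \<open>y\<close>, the Lipschitz bound makes the derivative of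
the left-hand side minus the right-hand side nonpositive.\<close>

lemma descent_inequality:
  fixes g :: "'a::euclidean_space \<Rightarrow> real"
  assumes diff: "\<And>x. g differentiable (at x)" and lip: "L-lipschitz_on UNIV (gradient g)"
  shows "g y \<le> g x + inner (gradient g x) (y - x) + L / 2 * (norm (y - x))\<^sup>2"
proof -
  define h where "h = y - x"
  define \<psi> where "\<psi> t = g (x + t *\<^sub>R h) - t * inner (gradient g x) h - L / 2 * t\<^sup>2 * (norm h)\<^sup>2" for t :: real
  have "\<psi> 1 \<le> \<psi> 0"
  proof (rule DERIV_nonpos_imp_nonincreasing[where f=\<psi>])
    fix t :: real assume t: "0 \<le> t"
    let ?D = "inner h (gradient g (x + t *\<^sub>R h)) - inner (gradient g x) h - L * t * (norm h)\<^sup>2"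
    have "((\<lambda>t. x + t *\<^sub>R h) has_derivative (\<lambda>t. t *\<^sub>R h)) (at t)"
      by (auto intro!: derivative_eq_intros)
    then have "((\<lambda>t. g (x + t *\<^sub>R h)) has_derivative (\<lambda>r. inner (r *\<^sub>R h) (gradient g (x + t *\<^sub>R h)))) (at t)"
      using differentiable_imp_GDERIV_gradient[OF diff, of "x + t *\<^sub>R h"] unfolding gderiv_def
      by (rule has_derivative_compose)
    then have "((\<lambda>t. g (x + t *\<^sub>R h)) has_real_derivative inner h (gradient g (x + t *\<^sub>R h))) (at t)"
      by (simp add: has_field_derivative_def mult_commute_abs)
    then have "(\<psi> has_real_derivative ?D) (at t)"
      unfolding \<psi>_def[abs_def] by (auto intro!: derivative_eq_intros)
    moreover have "inner h (gradient g (x + t *\<^sub>R h)) - inner (gradient g x) h \<le> L * t * (norm h)\<^sup>2"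
    proof -
      have "inner h (gradient g (x + t *\<^sub>R h)) - inner (gradient g x) h
          = inner (gradient g (x + t *\<^sub>R h) - gradient g x) h"
        by (simp add: inner_diff_right inner_commute)
      also have "\<dots> \<le> norm (gradient g (x + t *\<^sub>R h) - gradient g x) * norm h"
        by (rule norm_cauchy_schwarz)
      also have "\<dots> \<le> (L * (t * norm h)) * norm h"
        using lipschitz_onD[OF lip, of "x + t *\<^sub>R h" x] t
        by (intro mult_right_mono) (auto simp: dist_norm)
      finally show ?thesis by (simp add: power2_eq_square mult_ac)
    qed
    ultimately show "\<exists>D. (\<psi> has_real_derivative D) (at t) \<and> D \<le> 0"
      by (intro exI[of _ ?D]) auto
  qed simp
  then show ?thesis
    by (simp add: \<psi>_def h_def)
qed

text \<open>Divide the convexity inequality at the point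
\<open>x + a * (y - x)\<close> by \<open>a\<close> and let \<open>a\<close> tend to \<open>0\<close>.\<close>

lemma strongly_convex_gradient_lower_bound:
  fixes g :: "'a::euclidean_space \<Rightarrow> real"
  assumes sc: "strongly_convex s g" and diff: "g differentiable (at x)"
  shows "g x + inner (gradient g x) (y - x) + s / 2 * (norm (y - x))\<^sup>2 \<le> g y"
proof -
  define a where "a n = inverse (real (Suc n))" for n
  have a: "0 < a n" "a n \<le> 1" for n
    by (auto simp: a_def field_simps)
  have "(\<lambda>n. real (Suc n) *\<^sub>R (g (x + a n *\<^sub>R (y - x)) - g x)) \<longlonglongrightarrow> inner (y - x) (gradient g x)"
    using differentiable_imp_GDERIV_gradient[OF diff] unfolding gderiv_def a_def
    by (rule has_derivative_directional_LIMSEQ)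
  moreover have "a \<longlonglongrightarrow> 0"
    unfolding a_def[abs_def] by (rule LIMSEQ_inverse_real_of_nat)
  then have "(\<lambda>n. g y - g x - s / 2 * (1 - a n) * (norm (y - x))\<^sup>2)
      \<longlonglongrightarrow> g y - g x - s / 2 * (1 - 0) * (norm (y - x))\<^sup>2"
    by (intro tendsto_intros)
  moreover have "real (Suc n) *\<^sub>R (g (x + a n *\<^sub>R (y - x)) - g x)
      \<le> g y - g x - s / 2 * (1 - a n) * (norm (y - x))\<^sup>2" for n
  proof -
    have "g (a n *\<^sub>R y + (1 - a n) *\<^sub>R x)
        \<le> a n * g y + (1 - a n) * g x - s / 2 * a n * (1 - a n) * (norm (y - x))\<^sup>2"
      using sc a[of n] unfolding strongly_convex_def by auto
    then have "g (x + a n *\<^sub>R (y - x)) - g x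
        \<le> a n * (g y - g x - s / 2 * (1 - a n) * (norm (y - x))\<^sup>2)"
      by (simp add: algebra_simps)
    then have "inverse (a n) * (g (x + a n *\<^sub>R (y - x)) - g x)
        \<le> g y - g x - s / 2 * (1 - a n) * (norm (y - x))\<^sup>2"
      using a(1)[of n] by (simp add: field_simps)
    then show ?thesis
      by (simp add: a_def)
  qed
  ultimately have "inner (y - x) (gradient g x) \<le> g y - g x - s / 2 * (1 - 0) * (norm (y - x))\<^sup>2"
    by (intro LIMSEQ_le) auto
  then show ?thesis
    by (simp add: inner_commute)
qed

lemma convex_on_imp_strongly_convex_0: "convex_on UNIV g \<Longrightarrow> strongly_convex 0 g"
  unfolding strongly_convex_def convex_on_def
  by (auto dest!: spec)

text \<open>The lower bound of strong convexity around one of the points and the upper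
bound of the descent inequality around the other enclose the value of \<open>g\<close> at any third point. Evaluating them at \<open>y + a\<close>
and, with the roles exchanged, at \<open>x - a\<close>, the function values cancel in the sum and a quadratic inequality
in the displacement \<open>a\<close> remains. With \<open>d = x - y\<close>, it is sharpest when \<open>a\<close> is a multiple of the
part \<open>e\<close> of the gradient difference that exceeds \<open>s * d\<close>.\<close>

lemma gradient_coercive:
  fixes g :: "'a::euclidean_space \<Rightarrow> real"
  assumes sc: "strongly_convex s g" and diff: "\<And>x. g differentiable (at x)"
    and lip: "L-lipschitz_on UNIV (gradient g)" and s: "s \<ge> 0"
  shows "s * L * (norm (x - y))\<^sup>2 + (norm (gradient g x - gradient g y))\<^sup>2
    \<le> (s + L) * inner (gradient g x - gradient g y) (x - y)"
proof -
  define d e where "d = x - y" and "e = gradient g x - gradient g y - s *\<^sub>R d"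
  have grad_eq: "gradient g x - gradient g y = e + s *\<^sub>R d"
    by (simp add: e_def)
  have key: "inner (e + s *\<^sub>R d) d \<ge> 2 * inner (e + s *\<^sub>R d) a + s * (norm (d - a))\<^sup>2 - L * (norm a)\<^sup>2" for a
  proof -
    have "g x + inner (gradient g x) (a - d) + s / 2 * (norm (d - a))\<^sup>2
        \<le> g y + inner (gradient g y) a + L / 2 * (norm a)\<^sup>2"
      using strongly_convex_gradient_lower_bound[OF sc diff, of x "y + a"]
        descent_inequality[OF diff lip, of "y + a" y]
      by (simp add: d_def algebra_simps norm_minus_commute)
    moreover have "g y + inner (gradient g y) (d - a) + s / 2 * (norm (d - a))\<^sup>2
        \<le> g x + inner (gradient g x) (- a) + L / 2 * (norm a)\<^sup>2"
      using strongly_convex_gradient_lower_bound[OF sc diff, of y "x - a"]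
        descent_inequality[OF diff lip, of "x - a" x]
      by (simp add: d_def algebra_simps)
    ultimately show ?thesis
      unfolding grad_eq[symmetric] by (simp add: inner_diff_left inner_diff_right)
  qed
  have quad: "(2 * k - (L - s) * k\<^sup>2) * (norm e)\<^sup>2 \<le> inner e d" for k
    using key[of "k *\<^sub>R e"] unfolding power2_norm_eq_inner
    by (simp add: inner_commute[of d e] algebra_simps power2_eq_square)
  have main: "(norm e)\<^sup>2 \<le> (L - s) * inner e d"
  proof (cases "s < L")
    case True
    \<comment> \<open>The choice \<open>k = 1 / (L - s)\<close> maximizes the left-hand side of \<open>quad\<close>.\<close>
    have "2 * (1 / (L - s)) - (L - s) * (1 / (L - s))\<^sup>2 = 1 / (L - s)"
      using True by (simp add: power2_eq_square)
    then have "1 / (L - s) * (norm e)\<^sup>2 \<le> inner e d"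
      using quad[of "1 / (L - s)"] by simp
    then show ?thesis
      using True by (simp add: field_simps)
  next
    case False
    \<comment> \<open>The left-hand side of \<open>quad\<close> is unbounded in \<open>k\<close> unless \<open>e\<close> vanishes.\<close>
    have "e = 0"
    proof (rule ccontr)
      assume "e \<noteq> 0"
      then have pos: "(norm e)\<^sup>2 > 0" by simp
      define k where "k = (\<bar>inner e d\<bar> + 1) / (norm e)\<^sup>2"
      have "k * (norm e)\<^sup>2 = \<bar>inner e d\<bar> + 1" "k > 0"
        using pos by (auto simp: k_def)
      moreover have "2 * (k * (norm e)\<^sup>2) \<le> (2 * k - (L - s) * k\<^sup>2) * (norm e)\<^sup>2"
        using False pos by (simp add: algebra_simps mult_right_mono)
      ultimately show False
        using quad[of k] by linarith
    qed
    then show ?thesis by simp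
  qed
  then show ?thesis
    unfolding grad_eq d_def[symmetric] power2_norm_eq_inner
    by (simp add: inner_commute[of d e] algebra_simps)
qed

text \<open>A gradient step of size \<open>1 / L\<close> would lower the value by
\<open>\<parallel>\<nabla>g x\<parallel>\<^sup>2 / (2 * L)\<close>.\<close>

lemma gradient_minimizer_eq_0:
  fixes g :: "'a::euclidean_space \<Rightarrow> real"
  assumes diff: "\<And>x. g differentiable (at x)"
    and lip: "L-lipschitz_on UNIV (gradient g)" and L: "L > 0" and x: "x \<in> minimizers g"
  shows "gradient g x = 0"
proof -
  let ?y = "x - (1 / L) *\<^sub>R gradient g x"
  have "g x \<le> g ?y"
    using x by (simp add: minimizers_def)
  also have "\<dots> \<le> g x - (norm (gradient g x))\<^sup>2 / (2 * L)"
    using descent_inequality[OF diff lip, of ?y x] L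
    by (simp add: power_divide power2_norm_eq_inner[symmetric] field_simps power2_eq_square)
  finally have "(norm (gradient g x))\<^sup>2 \<le> 0"
    using L by (simp add: field_simps)
  then show ?thesis by simp
qed

lemma closed_minimizers:
  fixes g :: "'a::topological_space \<Rightarrow> real"
  assumes "continuous_on UNIV g"
  shows "closed (minimizers g)"
proof -
  have "minimizers g = (\<Inter>y. {x. g x \<le> g y})"
    by (auto simp: minimizers_def)
  then show ?thesis
    using assms by (auto intro!: closed_INT closed_Collect_le)
qed

text \<open>The quadratic lower bound at \<open>0\<close> shows that \<open>g\<close> exceeds \<open>g 0\<close> outside a
ball, so a minimum over this compact ball is global. Two minimizers would have a midpoint with a smaller value.\<close>

lemma strongly_convex_unique_minimizer:
  fixes g :: "'a::euclidean_space \<Rightarrow> real"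
  assumes sc: "strongly_convex s g" and s: "s > 0" and diff: "\<And>x. g differentiable (at x)"
  shows "\<exists>x. minimizers g = {x}"
proof -
  define R where "R = 2 * norm (gradient g 0) / s"
  have cont: "continuous_on UNIV g"
    using diff by (simp add: continuous_on_eq_continuous_at differentiable_imp_continuous_within)
  have R: "R \<ge> 0"
    using s by (simp add: R_def)
  obtain x where x: "\<And>y. norm y \<le> R \<Longrightarrow> g x \<le> g y"
  proof -
    have "\<exists>x\<in>cball 0 R. \<forall>y\<in>cball 0 R. g x \<le> g y"
      using R continuous_on_subset[OF cont] by (intro continuous_attains_inf) auto
    then show ?thesis
      using that by (auto simp: Ball_def)
  qed
  have "g x \<le> g y" for y
  proof (cases "norm y \<le> R")
    case False
    have "g x \<le> g 0"
      using x[of 0] R by simp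
    moreover have "norm (gradient g 0) * norm y \<le> (s / 2 * norm y) * norm y"
      using False s by (intro mult_right_mono) (auto simp: R_def field_simps)
    then have "norm (gradient g 0) * norm y \<le> s / 2 * (norm y)\<^sup>2"
      by (simp add: power2_eq_square)
    moreover have "- inner (gradient g 0) y \<le> norm (gradient g 0) * norm y"
      using norm_cauchy_schwarz[of "- gradient g 0" y] by simp
    ultimately show ?thesis
      using strongly_convex_gradient_lower_bound[OF sc diff, of 0 y] by simp
  qed (use x in auto)
  then have "x \<in> minimizers g"
    by (simp add: minimizers_def)
  moreover have "y = x" if y: "y \<in> minimizers g" for y
  proof -
    have "g x = g y"
      using y \<open>x \<in> minimizers g\<close> by (auto simp: minimizers_def intro: antisym)
    moreover have "g ((1/2) *\<^sub>R x + (1 - 1/2) *\<^sub>R y)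
        \<le> 1/2 * g x + (1 - 1/2) * g y - s / 2 * (1/2) * (1 - 1/2) * (norm (x - y))\<^sup>2"
      using sc[unfolded strongly_convex_def, rule_format, of "1/2" x y] by simp
    moreover have "g y \<le> g ((1/2) *\<^sub>R x + (1 - 1/2) *\<^sub>R y)"
      using y unfolding minimizers_def by blast
    ultimately have "s * (norm (x - y))\<^sup>2 \<le> 0" by simp
    then show "y = x"
      using s by (simp add: mult_le_0_iff)
  qed
  ultimately show ?thesis by blast
qed

text \<open>In the expansion of the squared norm, \<open>gradient_coercive\<close>
bounds the inner product from below, and \<open>\<gamma> \<le> 2 / (s + L)\<close> makes the total coefficient of
\<open>\<parallel>\<nabla>g x\<parallel>\<^sup>2\<close> nonpositive.\<close>

lemma gradient_step_contraction_strongly_convex: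
  fixes g :: "'a::euclidean_space \<Rightarrow> real"
  assumes sc: "strongly_convex s g" and diff: "\<And>x. g differentiable (at x)"
    and lip: "L-lipschitz_on UNIV (gradient g)" and "s > 0" "L > 0"
    and y: "y \<in> minimizers g" and \<gamma>: "0 < \<gamma>" "\<gamma> \<le> 2 / (s + L)"
  shows "norm (x - \<gamma> *\<^sub>R gradient g x - y) \<le> sqrt (1 - 2 * \<gamma> * s * L / (s + L)) * norm (x - y)"
proof -
  let ?G = "gradient g x"
  have *: "s * L * (norm (x - y))\<^sup>2 + (norm ?G)\<^sup>2 \<le> (s + L) * inner ?G (x - y)"
    using gradient_coercive[OF sc diff lip, of x y] gradient_minimizer_eq_0[OF diff lip \<open>L > 0\<close> y] \<open>s > 0\<close>
    by simp
  have "(norm (x - \<gamma> *\<^sub>R ?G - y))\<^sup>2 = (norm (x - y))\<^sup>2 - 2 * \<gamma> * inner ?G (x - y) + \<gamma>\<^sup>2 * (norm ?G)\<^sup>2"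
    unfolding power2_norm_eq_inner by (simp add: algebra_simps inner_commute power2_eq_square)
  also have "\<dots> \<le> (norm (x - y))\<^sup>2 - 2 * \<gamma> * inner ?G (x - y) + \<gamma> * (2 / (s + L)) * (norm ?G)\<^sup>2"
    using mult_right_mono[OF mult_left_mono[OF \<gamma>(2), of \<gamma>], of "(norm ?G)\<^sup>2"] \<gamma>(1)
    by (simp add: power2_eq_square)
  also have "\<dots> \<le> (norm (x - y))\<^sup>2 - 2 * \<gamma> * ((s * L * (norm (x - y))\<^sup>2 + (norm ?G)\<^sup>2) / (s + L))
      + \<gamma> * (2 / (s + L)) * (norm ?G)\<^sup>2"
    using * \<gamma> \<open>s > 0\<close> \<open>L > 0\<close> by (simp add: divide_le_eq mult.commute)
  also have "\<dots> = (1 - 2 * \<gamma> * s * L / (s + L)) * (norm (x - y))\<^sup>2"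
    by (simp add: algebra_simps add_divide_distrib)
  finally have "sqrt ((norm (x - \<gamma> *\<^sub>R ?G - y))\<^sup>2) \<le> sqrt ((1 - 2 * \<gamma> * s * L / (s + L)) * (norm (x - y))\<^sup>2)"
    by (rule real_sqrt_le_mono)
  then show ?thesis
    by (simp add: real_sqrt_mult)
qed

text \<open>Smoothness and convexity give
\<open>\<parallel>x - \<gamma> * \<nabla>g x - y\<parallel>\<^sup>2 \<le> \<parallel>x - y\<parallel>\<^sup>2 - \<gamma> * (2 - \<gamma> * L) / L * \<parallel>\<nabla>g x\<parallel>\<^sup>2\<close>. Growth and convexity yield
\<open>s / 2 * \<parallel>x - y\<parallel>\<^sup>2 \<le> g x - g y \<le> \<langle>\<nabla>g x, x - y\<rangle>\<close>, so the gradient is at least \<open>s / 2 * \<parallel>x - y\<parallel>\<close> long.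

The radicand may be negative, for example if \<open>g\<close> is constant and \<open>s\<close> is large. The estimate of the squares
then forces \<open>x = y\<close>, and the bound survives because \<open>sqrt\<close> is multiplicative on all reals.\<close>

lemma gradient_step_contraction_quadratic_growth:
  fixes g :: "'a::euclidean_space \<Rightarrow> real"
  assumes conv: "convex_on UNIV g" and diff: "\<And>x. g differentiable (at x)"
    and lip: "L-lipschitz_on UNIV (gradient g)" and "s > 0" "L > 0"
    and y: "y \<in> minimizers g" and growth: "s / 2 * (norm (x - y))\<^sup>2 \<le> g x - g y"
    and \<gamma>: "0 < \<gamma>" "\<gamma> < 2 / L"
  shows "norm (x - \<gamma> *\<^sub>R gradient g x - y)
    \<le> sqrt (1 - \<gamma> * s\<^sup>2 * (2 - \<gamma> * L) / (4 * L)) * norm (x - y)"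
proof -
  let ?G = "gradient g x"
  note sc = convex_on_imp_strongly_convex_0[OF conv]
  have *: "(norm ?G)\<^sup>2 \<le> L * inner ?G (x - y)"
    using gradient_coercive[OF sc diff lip, of x y] gradient_minimizer_eq_0[OF diff lip \<open>L > 0\<close> y]
    by simp
  have "s / 2 * norm (x - y) \<le> norm ?G"
  proof (cases "x = y")
    case False
    have "s / 2 * (norm (x - y))\<^sup>2 \<le> inner ?G (x - y)"
      using growth strongly_convex_gradient_lower_bound[OF sc diff, of x y]
      by (simp add: inner_diff_right)
    also have "\<dots> \<le> norm ?G * norm (x - y)"
      by (rule norm_cauchy_schwarz)
    finally have "(s / 2 * norm (x - y)) * norm (x - y) \<le> norm ?G * norm (x - y)"
      by (simp add: power2_eq_square mult_ac)
    then show ?thesis using False by simp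
  qed simp
  then have "(s / 2 * norm (x - y))\<^sup>2 \<le> (norm ?G)\<^sup>2"
    using \<open>s > 0\<close> by (intro power_mono) auto
  then have **: "s\<^sup>2 / 4 * (norm (x - y))\<^sup>2 \<le> (norm ?G)\<^sup>2"
    by (simp add: power_mult_distrib power_divide)
  have pos: "0 \<le> \<gamma> * (2 - \<gamma> * L) / L"
    using \<gamma> \<open>L > 0\<close> by (simp add: field_simps)
  have "(norm (x - \<gamma> *\<^sub>R ?G - y))\<^sup>2 = (norm (x - y))\<^sup>2 - 2 * \<gamma> * inner ?G (x - y) + \<gamma>\<^sup>2 * (norm ?G)\<^sup>2"
    unfolding power2_norm_eq_inner by (simp add: algebra_simps inner_commute power2_eq_square)
  also have "\<dots> \<le> (norm (x - y))\<^sup>2 - 2 * \<gamma> * ((norm ?G)\<^sup>2 / L) + \<gamma>\<^sup>2 * (norm ?G)\<^sup>2"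
    using * \<gamma> \<open>L > 0\<close> by (simp add: divide_le_eq mult.commute)
  also have "\<dots> = (norm (x - y))\<^sup>2 - \<gamma> * (2 - \<gamma> * L) / L * (norm ?G)\<^sup>2"
    using \<open>L > 0\<close> by (simp add: field_simps power2_eq_square)
  also have "\<dots> \<le> (norm (x - y))\<^sup>2 - \<gamma> * (2 - \<gamma> * L) / L * (s\<^sup>2 / 4 * (norm (x - y))\<^sup>2)"
    using mult_left_mono[OF ** pos] by linarith
  also have "\<dots> = (1 - \<gamma> * s\<^sup>2 * (2 - \<gamma> * L) / (4 * L)) * (norm (x - y))\<^sup>2"
    using \<open>L > 0\<close> by (simp add: field_simps)
  finally have "sqrt ((norm (x - \<gamma> *\<^sub>R ?G - y))\<^sup>2)
      \<le> sqrt ((1 - \<gamma> * s\<^sup>2 * (2 - \<gamma> * L) / (4 * L)) * (norm (x - y))\<^sup>2)"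
    by (rule real_sqrt_le_mono)
  then show ?thesis
    by (simp add: real_sqrt_mult)
qed

section \<open>Geometric decay of coupled linear recursions\<close>

text \<open>With a suitable weight \<open>v\<close>, the combination \<open>x + v * y\<close> is a
Lyapunov function. It contracts if \<open>a + v * c < 1\<close> and \<open>b / v + d < 1\<close>, that is, if \<open>v\<close> lies strictly
between \<open>b / (1 - d)\<close> and \<open>(1 - a) / c\<close>; the assumption on the determinant says that this interval is
nonempty. A negative \<open>a\<close> does no harm, because the Lyapunov estimate
only bounds \<open>a + v * c\<close> from above.\<close>

lemma coupled_recursion_geometric_decay:
  fixes a b c d :: real
  assumes nonneg: "0 \<le> b" "0 \<le> c" "0 \<le> d" and lt: "a < 1" "d < 1"
    and det: "b * c < (1 - a) * (1 - d)"
  shows "\<exists>C \<rho>. C > 0 \<and> 0 < \<rho> \<and> \<rho> < 1 \<and>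
    (\<forall>x y. (\<forall>t. 0 \<le> x t \<and> 0 \<le> y t
        \<and> x (Suc t) \<le> a * x t + b * y t \<and> y (Suc t) \<le> c * x t + d * y t) \<longrightarrow>
      (\<forall>t. norm (x t, y t) \<le> C * \<rho> ^ t * norm (x 0, y 0)))"
proof -
  \<comment> \<open>The denominator \<open>c + 1\<close> keeps \<open>v\<close> below \<open>(1 - a) / c\<close> and also covers \<open>c = 0\<close>.\<close>
  define \<eta> where "\<eta> = ((1 - a) - b * c / (1 - d)) / (c + 1)"
  define v where "v = b / (1 - d) + \<eta>"
  have gap: "0 < (1 - a) - b * c / (1 - d)"
    using det lt by (simp add: field_simps)
  then have \<eta>: "\<eta> > 0" "\<eta> * (c + 1) = (1 - a) - b * c / (1 - d)"
    using nonneg by (auto simp: \<eta>_def)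
  have v: "v > 0"
    using \<eta>(1) nonneg lt by (simp add: v_def add_nonneg_pos)
  have "v * c = b * c / (1 - d) + \<eta> * c"
    by (simp add: v_def algebra_simps)
  also have "\<dots> < 1 - a"
    using \<eta> by (simp add: algebra_simps)
  finally have v1: "a + v * c < 1" by simp
  have "v * (1 - d) = b + \<eta> * (1 - d)"
    using lt by (simp add: v_def field_simps)
  also have "\<dots> > b"
    using \<eta>(1) lt by simp
  finally have v2: "b / v + d < 1"
    using v by (simp add: field_simps)
  \<comment> \<open>The entry \<open>1 / 2\<close> only ensures that the rate is positive.\<close>
  define \<rho> where "\<rho> = max (1 / 2) (max (a + v * c) (b / v + d))"
  define C where "C = (1 + 1 / v) * (1 + v)"
  have \<rho>: "0 < \<rho>" "\<rho> < 1" "a + v * c \<le> \<rho>" "b / v + d \<le> \<rho>"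
    using v1 v2 by (auto simp: \<rho>_def)
  have "norm (x t, y t) \<le> C * \<rho> ^ t * norm (x 0, y 0)"
    if xy: "\<forall>t. 0 \<le> x t \<and> 0 \<le> y t
        \<and> x (Suc t) \<le> a * x t + b * y t \<and> y (Suc t) \<le> c * x t + d * y t"
    for x y :: "nat \<Rightarrow> real" and t
  proof -
    define V where "V t = x t + v * y t" for t
    have "V (Suc t) \<le> \<rho> * V t" for t
    proof -
      have "V (Suc t) \<le> (a * x t + b * y t) + v * (c * x t + d * y t)"
        unfolding V_def using xy v by (intro add_mono mult_left_mono) auto
      also have "\<dots> = (a + v * c) * x t + (b / v + d) * (v * y t)"
        using v by (simp add: field_simps)
      also have "\<dots> \<le> \<rho> * x t + \<rho> * (v * y t)"
        using xy v \<rho> by (intro add_mono mult_right_mono) auto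
      finally show ?thesis by (simp add: V_def algebra_simps)
    qed
    then have decay: "V t \<le> \<rho> ^ t * V 0"
    proof (induction t)
      case (Suc t)
      have "V (Suc t) \<le> \<rho> * V t" by fact
      also have "\<dots> \<le> \<rho> * (\<rho> ^ t * V 0)"
        using Suc \<rho> by (intro mult_left_mono) auto
      finally show ?case by simp
    qed simp
    have V0: "0 \<le> V 0" "V 0 \<le> (1 + v) * norm (x 0, y 0)"
    proof -
      show "0 \<le> V 0"
        using xy v by (simp add: V_def)
      have "x 0 \<le> norm (x 0, y 0)" "y 0 \<le> norm (x 0, y 0)"
        using norm_fst_le[of "x 0" "y 0"] norm_snd_le[of "y 0" "x 0"] xy by auto
      then have "x 0 + v * y 0 \<le> norm (x 0, y 0) + v * norm (x 0, y 0)"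
        using v by (intro add_mono mult_left_mono) auto
      then show "V 0 \<le> (1 + v) * norm (x 0, y 0)"
        by (simp add: V_def algebra_simps)
    qed
    have "norm (x t, y t) \<le> x t + y t"
      using norm_Pair_le[of "x t" "y t"] xy by simp
    also have "\<dots> \<le> (x t + y t) + (x t / v + v * y t)"
      using xy v by simp
    also have "\<dots> = (1 + 1 / v) * V t"
      using v by (simp add: V_def field_simps)
    also have "\<dots> \<le> (1 + 1 / v) * (\<rho> ^ t * ((1 + v) * norm (x 0, y 0)))"
      using v \<rho> decay V0 by (intro mult_left_mono order_trans[OF decay]) auto
    finally show ?thesis by (simp add: C_def mult_ac)
  qed
  then show ?thesis
    using \<rho> v by (intro exI[of _ C] exI[of _ \<rho>]) (auto simp: C_def intro!: mult_pos_pos add_pos_pos)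
qed

section \<open>Recursions driven by independent inputs\<close>

text \<open>The state of a recursion driven by \<open>r\<close> is a measurable function of the past inputs, hence independent of
the next one. Independence is expressed by the product form of the joint distribution, since state and
input have different types.\<close>

lemma (in prob_space) driven_recursion_indep_next_input:
  assumes indep: "indep_vars (\<lambda>_. B) r UNIV"
    and G: "(\<lambda>(y, d). G y d) \<in> measurable (N \<Otimes>\<^sub>M B) N" and y0: "y0 \<in> space N"
    and init: "\<And>\<omega>. \<omega> \<in> space M \<Longrightarrow> Y 0 \<omega> = y0"
    and step: "\<And>t \<omega>. \<omega> \<in> space M \<Longrightarrow> Y (Suc t) \<omega> = G (Y t \<omega>) (r t \<omega>)"
  shows "random_variable N (Y t)"
    and "distr M N (Y t) \<Otimes>\<^sub>M distr M B (r t) = distr M (N \<Otimes>\<^sub>M B) (\<lambda>\<omega>. (Y t \<omega>, r t \<omega>))"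
proof -
  \<comment> \<open>The state at time \<open>t\<close> factors through the restriction of the input sequence to the times before \<open>t\<close>.\<close>
  have "\<exists>Z \<in> measurable (PiM {..<t} (\<lambda>_. B)) N.
      \<forall>\<omega>\<in>space M. Y t \<omega> = Z (\<lambda>i\<in>{..<t}. r i \<omega>)"
  proof (induction t)
    case 0
    show ?case
    proof (rule bexI[of _ "\<lambda>_. y0"])
      show "\<forall>\<omega>\<in>space M. Y 0 \<omega> = (\<lambda>_. y0) (\<lambda>i\<in>{..<0}. r i \<omega>)"
        using init by blast
    qed (rule measurable_const[OF y0])
  next
    case (Suc t)
    then obtain Z where Z: "Z \<in> measurable (PiM {..<t} (\<lambda>_. B)) N"
      "\<And>\<omega>. \<omega> \<in> space M \<Longrightarrow> Y t \<omega> = Z (\<lambda>i\<in>{..<t}. r i \<omega>)" by blast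
    let ?Z = "\<lambda>p. case_prod G (Z (restrict p {..<t}), p t)"
    have "(\<lambda>p. restrict p {..<t}) \<in> measurable (PiM {..<Suc t} (\<lambda>_. B)) (PiM {..<t} (\<lambda>_. B))"
      by (rule measurable_restrict_subset) auto
    then have "(\<lambda>p. Z (restrict p {..<t})) \<in> measurable (PiM {..<Suc t} (\<lambda>_. B)) N"
      using Z(1) by (rule measurable_compose)
    moreover have "(\<lambda>p. p t) \<in> measurable (PiM {..<Suc t} (\<lambda>_. B)) B"
      by (rule measurable_component_singleton) simp
    ultimately have "?Z \<in> measurable (PiM {..<Suc t} (\<lambda>_. B)) N"
      by (rule measurable_compose[OF measurable_Pair G])
    moreover have "Y (Suc t) \<omega> = ?Z (\<lambda>i\<in>{..<Suc t}. r i \<omega>)" if "\<omega> \<in> space M" for \<omega>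
    proof -
      have "restrict (\<lambda>i\<in>{..<Suc t}. r i \<omega>) {..<t} = (\<lambda>i\<in>{..<t}. r i \<omega>)"
        by (auto simp: fun_eq_iff)
      then show ?thesis
        using step[OF that] Z(2)[OF that] by simp
    qed
    ultimately show ?case
      by (intro bexI[of _ ?Z] ballI)
  qed
  then obtain Z where Z: "Z \<in> measurable (PiM {..<t} (\<lambda>_. B)) N"
    "\<And>\<omega>. \<omega> \<in> space M \<Longrightarrow> Y t \<omega> = Z (\<lambda>i\<in>{..<t}. r i \<omega>)" by blast
  let ?past = "\<lambda>\<omega>. \<lambda>i\<in>{..<t}. r i \<omega>" and ?now = "\<lambda>\<omega>. \<lambda>i\<in>{t}. r i \<omega>"
  let ?P = "PiM {..<t} (\<lambda>_. B)" and ?Q = "PiM {t} (\<lambda>_. B)"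
  have "indep_var ?P ?past ?Q ?now"
    using indep_var_restrict[OF indep, of "{..<t}" "{t}"] by simp
  then have past: "random_variable ?P ?past" and now: "random_variable ?Q ?now"
    and joint: "distr M ?P ?past \<Otimes>\<^sub>M distr M ?Q ?now = distr M (?P \<Otimes>\<^sub>M ?Q) (\<lambda>\<omega>. (?past \<omega>, ?now \<omega>))"
    unfolding indep_var_distribution_eq by blast+
  have eval: "(\<lambda>p. p t) \<in> measurable ?Q B"
    by (rule measurable_component_singleton) simp
  have r: "random_variable B (r t)"
    using indep by (auto simp: indep_vars_def)
  have Zpast: "random_variable N (\<lambda>\<omega>. Z (?past \<omega>))"
    using past Z(1) by (rule measurable_compose)
  then show Y: "random_variable N (Y t)"
    by (subst measurable_cong[OF Z(2)])
  interpret R: prob_space "distr M B (r t)"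
    using r by (rule prob_space_distr)
  have "distr M N (Y t) = distr M N (Z \<circ> ?past)"
    by (intro distr_cong) (simp_all add: Z(2))
  then have Yd: "distr M N (Y t) = distr (distr M ?P ?past) N Z"
    using distr_distr[OF Z(1) past] by simp
  have rd: "distr M B (r t) = distr (distr M ?Q ?now) B (\<lambda>p. p t)"
    using distr_distr[OF eval now] by (simp add: comp_def)
  have "distr M N (Y t) \<Otimes>\<^sub>M distr M B (r t)
      = distr (distr M ?P ?past \<Otimes>\<^sub>M distr M ?Q ?now) (N \<Otimes>\<^sub>M B) (\<lambda>(x, y). (Z x, y t))"
    unfolding Yd rd
    by (rule pair_measure_distr) (simp_all add: Z(1) eval R.sigma_finite_measure_axioms flip: rd)
  also have "\<dots> = distr M (N \<Otimes>\<^sub>M B) ((\<lambda>(x, y). (Z x, y t)) \<circ> (\<lambda>\<omega>. (?past \<omega>, ?now \<omega>)))"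
    unfolding joint
  proof (rule distr_distr)
    show "(\<lambda>(x, y). (Z x, y t)) \<in> measurable (?P \<Otimes>\<^sub>M ?Q) (N \<Otimes>\<^sub>M B)"
      unfolding split_beta'
      by (intro measurable_Pair measurable_compose[OF measurable_fst Z(1)]
          measurable_compose[OF measurable_snd eval])
    show "random_variable (?P \<Otimes>\<^sub>M ?Q) (\<lambda>\<omega>. (?past \<omega>, ?now \<omega>))"
      using past now by (rule measurable_Pair)
  qed
  also have "\<dots> = distr M (N \<Otimes>\<^sub>M B) (\<lambda>\<omega>. (Y t \<omega>, r t \<omega>))"
    by (intro distr_cong) (simp_all add: Z(2))
  finally show "distr M N (Y t) \<Otimes>\<^sub>M distr M B (r t) = distr M (N \<Otimes>\<^sub>M B) (\<lambda>\<omega>. (Y t \<omega>, r t \<omega>))" .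
qed

text \<open>An expectation bound that holds for every fixed \<open>x\<close> may be averaged over an independent \<open>X\<close>, by
Tonelli's theorem. This replaces conditioning on the past. Integrability of \<open>h (X _) (R _)\<close> is part of the
conclusion, so that it can be propagated along the trajectory.\<close>

lemma (in prob_space) expectation_indep_le:
  fixes h :: "'s \<Rightarrow> 'd \<Rightarrow> real" and w :: "'s \<Rightarrow> real"
  assumes X: "random_variable N X" and R: "random_variable B R"
    and joint: "distr M N X \<Otimes>\<^sub>M distr M B R = distr M (N \<Otimes>\<^sub>M B) (\<lambda>\<omega>. (X \<omega>, R \<omega>))"
    and h: "(\<lambda>(x, d). h x d) \<in> borel_measurable (N \<Otimes>\<^sub>M B)" and h_nonneg: "\<And>x d. 0 \<le> h x d"
    and int: "\<And>x. x \<in> space N \<Longrightarrow> integrable M (\<lambda>\<omega>. h x (R \<omega>))"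
    and le: "\<And>x. x \<in> space N \<Longrightarrow> (\<integral>\<omega>. h x (R \<omega>) \<partial>M) \<le> w x"
    and w: "w \<in> borel_measurable N" "integrable M (\<lambda>\<omega>. w (X \<omega>))"
  shows "integrable M (\<lambda>\<omega>. h (X \<omega>) (R \<omega>))"
    and "(\<integral>\<omega>. h (X \<omega>) (R \<omega>) \<partial>M) \<le> (\<integral>\<omega>. w (X \<omega>) \<partial>M)"
proof -
  note [measurable] = X R
  have h1: "(\<lambda>p. h (fst p) (snd p)) \<in> borel_measurable (N \<Otimes>\<^sub>M B)"
    using h by (simp add: split_beta')
  have XR: "(\<lambda>\<omega>. (X \<omega>, R \<omega>)) \<in> measurable M (N \<Otimes>\<^sub>M B)"
    by measurable
  have meas: "(\<lambda>\<omega>. h (X \<omega>) (R \<omega>)) \<in> borel_measurable M"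
    using measurable_compose[OF XR h1] by simp
  have w_nonneg: "0 \<le> w x" if "x \<in> space N" for x
    using h_nonneg by (intro order_trans[OF integral_nonneg_AE le[OF that]]) simp
  interpret R: prob_space "distr M B R"
    using R by (rule prob_space_distr)
  have h2: "(\<lambda>p. ennreal (h (fst p) (snd p))) \<in> borel_measurable (distr M N X \<Otimes>\<^sub>M distr M B R)"
    using h1 by (simp cong: measurable_cong_sets)
  have "(\<integral>\<^sup>+\<omega>. ennreal (h (X \<omega>) (R \<omega>)) \<partial>M)
      = (\<integral>\<^sup>+p. ennreal (h (fst p) (snd p)) \<partial>distr M (N \<Otimes>\<^sub>M B) (\<lambda>\<omega>. (X \<omega>, R \<omega>)))"
    using h1 XR by (simp add: nn_integral_distr)
  also have "\<dots> = (\<integral>\<^sup>+x. \<integral>\<^sup>+d. ennreal (h x d) \<partial>distr M B R \<partial>distr M N X)"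
    using R.nn_integral_fst[OF h2] unfolding joint fst_conv snd_conv by (rule sym)
  also have "\<dots> \<le> (\<integral>\<^sup>+x. ennreal (w x) \<partial>distr M N X)"
  proof (rule nn_integral_mono)
    fix x assume "x \<in> space (distr M N X)"
    then have x: "x \<in> space N" by simp
    have "(\<lambda>d. h x d) \<in> borel_measurable B"
      using measurable_compose[OF measurable_Pair1'[OF x] h1] by simp
    then have "(\<integral>\<^sup>+d. ennreal (h x d) \<partial>distr M B R) = (\<integral>\<^sup>+\<omega>. ennreal (h x (R \<omega>)) \<partial>M)"
      by (simp add: nn_integral_distr)
    also have "\<dots> = ennreal (\<integral>\<omega>. h x (R \<omega>) \<partial>M)"
      using int[OF x] h_nonneg by (intro nn_integral_eq_integral) auto
    also have "\<dots> \<le> ennreal (w x)"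
      using le[OF x] by (rule ennreal_leI)
    finally show "(\<integral>\<^sup>+d. ennreal (h x d) \<partial>distr M B R) \<le> ennreal (w x)" .
  qed
  also have "\<dots> = (\<integral>\<^sup>+\<omega>. ennreal (w (X \<omega>)) \<partial>M)"
    using w(1) by (simp add: nn_integral_distr)
  also have "\<dots> = ennreal (\<integral>\<omega>. w (X \<omega>) \<partial>M)"
    using w w_nonneg measurable_space[OF X] by (intro nn_integral_eq_integral) auto
  finally have bound: "(\<integral>\<^sup>+\<omega>. ennreal (h (X \<omega>) (R \<omega>)) \<partial>M) \<le> ennreal (\<integral>\<omega>. w (X \<omega>) \<partial>M)" .
  moreover have "\<dots> < \<infinity>"
    by simp
  ultimately have "(\<integral>\<^sup>+\<omega>. ennreal (norm (h (X \<omega>) (R \<omega>))) \<partial>M) < \<infinity>"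
    using h_nonneg by (simp add: le_less_trans)
  with meas show "integrable M (\<lambda>\<omega>. h (X \<omega>) (R \<omega>))"
    by (rule integrableI_bounded)
  show "(\<integral>\<omega>. h (X \<omega>) (R \<omega>) \<partial>M) \<le> (\<integral>\<omega>. w (X \<omega>) \<partial>M)"
    using bound w_nonneg measurable_space[OF X]
    by (intro integral_real_bounded integral_nonneg_AE AE_I2) simp_all
qed

section \<open>Linear convergence of the closed loop\<close>

text \<open>The relaxed step along \<open>w\<close> is the convex combination of \<open>u\<close> and the full
step along \<open>v\<close> with weights \<open>1 - \<delta>\<close> and \<open>\<delta>\<close>, perturbed by \<open>(\<delta> * \<gamma>) * (w - v)\<close>.\<close>

lemma relaxed_inexact_step_bounds:
  fixes u y v w :: "'a::real_normed_vector"
  assumes \<delta>: "0 \<le> \<delta>" "\<delta> \<le> 1" and \<gamma>: "0 \<le> \<gamma>"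
    and contr: "norm (u - \<gamma> *\<^sub>R v - y) \<le> q * norm (u - y)"
    and err: "norm (w - v) \<le> \<epsilon>" and size: "norm v \<le> L * norm (u - y)"
  shows "norm (u - (\<delta> * \<gamma>) *\<^sub>R w - y) \<le> (1 - \<delta> * (1 - q)) * norm (u - y) + \<delta> * \<gamma> * \<epsilon>"
    and "norm ((\<delta> * \<gamma>) *\<^sub>R w) \<le> \<delta> * \<gamma> * (L * norm (u - y) + \<epsilon>)"
proof -
  have "u - (\<delta> * \<gamma>) *\<^sub>R w - y
      = ((1 - \<delta>) *\<^sub>R (u - y) + \<delta> *\<^sub>R (u - \<gamma> *\<^sub>R v - y)) - (\<delta> * \<gamma>) *\<^sub>R (w - v)"
    by (simp add: algebra_simps)
  also have "norm \<dots> \<le> norm ((1 - \<delta>) *\<^sub>R (u - y) + \<delta> *\<^sub>R (u - \<gamma> *\<^sub>R v - y))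
      + norm ((\<delta> * \<gamma>) *\<^sub>R (w - v))"
    by (rule norm_triangle_ineq4)
  also have "\<dots> \<le> (norm ((1 - \<delta>) *\<^sub>R (u - y)) + norm (\<delta> *\<^sub>R (u - \<gamma> *\<^sub>R v - y)))
      + norm ((\<delta> * \<gamma>) *\<^sub>R (w - v))"
    by (intro add_right_mono norm_triangle_ineq)
  also have "\<dots> = (1 - \<delta>) * norm (u - y) + \<delta> * norm (u - \<gamma> *\<^sub>R v - y) + \<delta> * \<gamma> * norm (w - v)"
    using \<delta> \<gamma> by simp
  also have "\<dots> \<le> (1 - \<delta>) * norm (u - y) + \<delta> * (q * norm (u - y)) + \<delta> * \<gamma> * \<epsilon>"
    using \<delta> \<gamma> contr err by (intro add_mono mult_left_mono) auto
  finally show "norm (u - (\<delta> * \<gamma>) *\<^sub>R w - y) \<le> (1 - \<delta> * (1 - q)) * norm (u - y) + \<delta> * \<gamma> * \<epsilon>"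
    by (simp add: algebra_simps)
  have "norm w \<le> L * norm (u - y) + \<epsilon>"
    using norm_triangle_ineq[of v "w - v"] err size by simp
  then show "norm ((\<delta> * \<gamma>) *\<^sub>R w) \<le> \<delta> * \<gamma> * (L * norm (u - y) + \<epsilon>)"
    using \<delta> \<gamma> by (simp add: mult_left_mono)
qed

text \<open>This is the common core of both parts: \<open>S\<close> stands for the set of minimizers and \<open>q\<close> for the
contraction factor of an exact gradient step towards a nearest point of \<open>S\<close>. The nearest point \<open>y\<close> to
the current input also bounds the distance of the next input to \<open>S\<close> from above, so one choice of \<open>y\<close> per step
serves both recursions.\<close>

lemma closed_loop_linear_decay:
  fixes M :: "'w measure"
    and r :: "nat \<Rightarrow> 'w \<Rightarrow> real^'p"
    and f :: "real^'m \<Rightarrow> real^'n \<Rightarrow> real^'p \<Rightarrow> real^'m"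
    and z_ss :: "real^'n \<Rightarrow> real^'m"
    and l :: "real^'m \<Rightarrow> real"
    and S :: "(real^'n) set"
  assumes M: "prob_space M"
    and indep: "prob_space.indep_vars M (\<lambda>_. borel) r UNIV"
    and f_meas: "(\<lambda>(z, u, d). f z u d) \<in> borel_measurable borel"
    and l_diff: "\<And>z. l differentiable (at z)"
    and zss_diff: "\<And>u. z_ss differentiable (at u)"
    and pos: "L > 0" "L_l > 0" "L_FIX > 0" "0 < c_F" "c_F < 1"
    and \<Phi>_lip: "L-lipschitz_on UNIV (gradient (\<lambda>u. l (z_ss u)))"
    and l_lip: "L_l-lipschitz_on UNIV (gradient l)"
    and zss_lip: "L_FIX-lipschitz_on UNIV z_ss"
    and contr_int: "\<And>z u t. integrable M (\<lambda>\<omega>. dist (f z u (r t \<omega>)) (z_ss u))"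
    and contr: "\<And>z u t. (\<integral>\<omega>. dist (f z u (r t \<omega>)) (z_ss u) \<partial>M) \<le> c_F * dist z (z_ss u)"
    and S: "closed S" "S \<noteq> {}" and S_grad: "\<And>y. y \<in> S \<Longrightarrow> gradient (\<lambda>u. l (z_ss u)) y = 0"
    and S_step: "\<And>u y. y \<in> S \<Longrightarrow> infdist u S = dist u y \<Longrightarrow>
      norm (u - \<gamma> *\<^sub>R gradient (\<lambda>u. l (z_ss u)) u - y) \<le> q * norm (u - y)"
    and q: "q < 1" and \<gamma>: "\<gamma> > 0"
    and \<delta>: "0 < \<delta>" "\<delta> < min (delta_bar q \<gamma> c_F L_FIX L_l L) 1"
  shows "\<exists>C \<rho>. C > 0 \<and> 0 < \<rho> \<and> \<rho> < 1 \<and>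
    (\<forall>u0 z0 u z. closed_loop M f z_ss l r \<gamma> \<delta> u0 z0 u z \<longrightarrow>
      (\<forall>t. integrable M (\<lambda>\<omega>. infdist (u t \<omega>) S) \<and>
           integrable M (\<lambda>\<omega>. dist (z t \<omega>) (z_ss (u t \<omega>))) \<and>
           norm (\<integral>\<omega>. infdist (u t \<omega>) S \<partial>M, \<integral>\<omega>. dist (z t \<omega>) (z_ss (u t \<omega>)) \<partial>M)
             \<le> C * \<rho> ^ t * norm (infdist u0 S, dist z0 (z_ss u0))))"
proof -
  interpret prob_space M by fact
  define g where "g = gradient (\<lambda>u. l (z_ss u))"
  define dir where "dir u z = transpose (jacobian z_ss (at u)) *v gradient l z" for u z
  define \<epsilon> where "\<epsilon> = L_FIX * L_l"
  define a b c d where "a = 1 - \<delta> * (1 - q)" and "b = \<delta> * \<gamma> * \<epsilon>"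
    and "c = L_FIX * (\<delta> * \<gamma> * L)" and "d = c_F + L_FIX * (\<delta> * \<gamma> * \<epsilon>)"

  \<comment> \<open>Cleared of its denominator, \<open>\<delta> < delta_bar\<close> is the determinant condition of the coupled recursion.\<close>
  have "\<delta> * (\<gamma> * L_FIX\<^sup>2 * L_l * ((1 - q) + \<gamma> * L)) < (1 - q) * (1 - c_F)"
    using \<delta>(2) pos q \<gamma> by (simp add: delta_bar_def less_divide_eq add_pos_pos)
  then have thr: "L_FIX * b * (1 - q) + L_FIX * b * (\<gamma> * L) < (1 - q) * (1 - c_F)"
    by (simp add: b_def \<epsilon>_def algebra_simps power2_eq_square)
  have Lb: "L_FIX * b > 0"
    using pos \<gamma> \<delta> by (simp add: b_def \<epsilon>_def)
  have d_lt: "d < 1"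
  proof -
    have "0 < L_FIX * b * (\<gamma> * L)"
      using Lb pos \<gamma> by simp
    then have "L_FIX * b * (1 - q) < (1 - q) * (1 - c_F)"
      using thr by linarith
    also have "\<dots> = (1 - c_F) * (1 - q)"
      by (rule mult.commute)
    finally have "L_FIX * b * (1 - q) < (1 - c_F) * (1 - q)" .
    then have "L_FIX * b < 1 - c_F"
      using q by simp
    then show ?thesis by (simp add: d_def b_def)
  qed
  have "\<delta> * (L_FIX * b * (\<gamma> * L)) < \<delta> * ((1 - q) * (1 - c_F) - L_FIX * b * (1 - q))"
    using thr \<delta> by (intro mult_strict_left_mono) linarith+
  then have det: "b * c < (1 - a) * (1 - d)"
    by (simp add: a_def b_def c_def d_def algebra_simps)
  have signs: "0 \<le> b" "0 \<le> c" "0 \<le> d" "a < 1"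
    using pos \<gamma> \<delta> q by (auto simp: a_def b_def c_def d_def \<epsilon>_def)
  from coupled_recursion_geometric_decay[OF signs(1-4) d_lt det]
  obtain C \<rho> where C\<rho>: "C > 0" "0 < \<rho>" "\<rho> < 1" and
    decay: "\<And>x y t. (\<And>t. 0 \<le> x t \<and> 0 \<le> y t \<and> x (Suc t) \<le> a * x t + b * y t
        \<and> y (Suc t) \<le> c * x t + d * y t) \<Longrightarrow> norm (x t, y t) \<le> C * \<rho> ^ t * norm (x 0, y 0)"
    by blast

  have grad: "g u = dir u (z_ss u)" for u
    unfolding g_def dir_def by (rule gradient_compose_jacobian[OF zss_diff l_diff])
  have dir_err: "norm (dir u z - g u) \<le> \<epsilon> * dist z (z_ss u)" for u z
  proof -
    have "dir u z - g u = transpose (jacobian z_ss (at u)) *v (gradient l z - gradient l (z_ss u))"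
      by (simp add: grad dir_def matrix_vector_mult_diff_distrib del: transpose_matrix_vector)
    also have "norm \<dots> \<le> L_FIX * norm (gradient l z - gradient l (z_ss u))"
      by (rule norm_transpose_jacobian_le[OF zss_diff zss_lip])
    also have "\<dots> \<le> L_FIX * (L_l * dist z (z_ss u))"
      using lipschitz_onD[OF l_lip, of z "z_ss u"] pos by (simp add: dist_norm)
    finally show ?thesis by (simp add: \<epsilon>_def)
  qed
  have step: "infdist (u - (\<delta> * \<gamma>) *\<^sub>R dir u z) S \<le> a * infdist u S + b * dist z (z_ss u)"
    "dist x (z_ss (u - (\<delta> * \<gamma>) *\<^sub>R dir u z))
      \<le> dist x (z_ss u) + (c * infdist u S + (d - c_F) * dist z (z_ss u))" for u z x
  proof -
    obtain y where y: "y \<in> S" "infdist u S = dist u y"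
      using infdist_attains_inf[OF S] by metis
    have "norm (g u) \<le> L * norm (u - y)"
      using lipschitz_onD[OF \<Phi>_lip, of u y] S_grad[OF y(1)] by (simp add: g_def dist_norm)
    note bounds = relaxed_inexact_step_bounds[OF _ _ _ S_step[OF y, folded g_def] dir_err[of u z] this, of \<delta>]
    have "infdist (u - (\<delta> * \<gamma>) *\<^sub>R dir u z) S \<le> norm (u - (\<delta> * \<gamma>) *\<^sub>R dir u z - y)"
      using infdist_le[OF y(1)] by (simp add: dist_norm)
    also have "\<dots> \<le> a * infdist u S + b * dist z (z_ss u)"
      using bounds(1) \<delta> \<gamma> by (simp add: y(2) dist_norm a_def b_def mult_ac)
    finally show "infdist (u - (\<delta> * \<gamma>) *\<^sub>R dir u z) S \<le> a * infdist u S + b * dist z (z_ss u)" .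
    have "dist (z_ss u) (z_ss (u - (\<delta> * \<gamma>) *\<^sub>R dir u z)) \<le> L_FIX * norm ((\<delta> * \<gamma>) *\<^sub>R dir u z)"
      using lipschitz_onD[OF zss_lip, of u "u - (\<delta> * \<gamma>) *\<^sub>R dir u z"] by (simp add: dist_norm)
    also have "\<dots> \<le> L_FIX * (\<delta> * \<gamma> * (L * norm (u - y) + \<epsilon> * dist z (z_ss u)))"
      using bounds(2) \<delta> \<gamma> pos by (intro mult_left_mono) auto
    also have "\<dots> = c * infdist u S + (d - c_F) * dist z (z_ss u)"
      by (simp add: y(2) dist_norm c_def d_def algebra_simps)
    finally show "dist x (z_ss (u - (\<delta> * \<gamma>) *\<^sub>R dir u z))
      \<le> dist x (z_ss u) + (c * infdist u S + (d - c_F) * dist z (z_ss u))"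
      using dist_triangle[of x "z_ss (u - (\<delta> * \<gamma>) *\<^sub>R dir u z)" "z_ss u"] by linarith
  qed

  let ?N = "borel \<Otimes>\<^sub>M borel :: ((real^'n) \<times> (real^'m)) measure"
  define G where "G = (\<lambda>(u, z) d. (u - (\<delta> * \<gamma>) *\<^sub>R dir u z, f z u d))"
  have [measurable]: "z_ss \<in> borel_measurable borel" "gradient l \<in> borel_measurable borel"
    using zss_lip l_lip by (auto intro!: borel_measurable_continuous_onI lipschitz_on_continuous_on)
  have dir_meas: "(\<lambda>(u, z). dir u z) \<in> borel_measurable ?N"
  proof -
    have "(\<lambda>p. (fst p, gradient l (snd p))) \<in> measurable ?N (borel \<Otimes>\<^sub>M borel)"
      by measurable
    from measurable_compose[OF this borel_measurable_transpose_jacobian[OF zss_diff]]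
    show ?thesis by (simp add: dir_def split_beta')
  qed
  have f_meas': "(\<lambda>p. f (snd (fst p)) (fst (fst p)) (snd p)) \<in> borel_measurable (?N \<Otimes>\<^sub>M borel)"
  proof -
    have "(\<lambda>p. (snd (fst p), fst (fst p), snd p)) \<in> measurable (?N \<Otimes>\<^sub>M (borel :: (real^'p) measure))
        (borel \<Otimes>\<^sub>M (borel \<Otimes>\<^sub>M borel))"
      by measurable
    then have "(\<lambda>p. (snd (fst p), fst (fst p), snd p)) \<in> borel_measurable (?N \<Otimes>\<^sub>M (borel :: (real^'p) measure))"
      by (simp add: borel_prod)
    from measurable_compose[OF this f_meas] show ?thesis by simp
  qed
  have G_meas: "(\<lambda>(y, d). G y d) \<in> measurable (?N \<Otimes>\<^sub>M borel) ?N"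
  proof -
    have "(\<lambda>p. dir (fst (fst p)) (snd (fst p))) \<in> borel_measurable (?N \<Otimes>\<^sub>M borel)"
      using measurable_compose[OF measurable_fst dir_meas] by (simp add: split_beta')
    then have "(\<lambda>p. (fst (fst p) - (\<delta> * \<gamma>) *\<^sub>R dir (fst (fst p)) (snd (fst p)),
        f (snd (fst p)) (fst (fst p)) (snd p))) \<in> measurable (?N \<Otimes>\<^sub>M borel) ?N"
      using f_meas' by measurable
    then show ?thesis by (simp add: G_def split_beta')
  qed

  have "integrable M (\<lambda>\<omega>. infdist (u t \<omega>) S) \<and> integrable M (\<lambda>\<omega>. dist (z t \<omega>) (z_ss (u t \<omega>))) \<and>
      norm (\<integral>\<omega>. infdist (u t \<omega>) S \<partial>M, \<integral>\<omega>. dist (z t \<omega>) (z_ss (u t \<omega>)) \<partial>M)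
        \<le> C * \<rho> ^ t * norm (infdist u0 S, dist z0 (z_ss u0))"
    if loop: "closed_loop M f z_ss l r \<gamma> \<delta> u0 z0 u z" for u0 z0 u z t
  proof -
    define Y where "Y t \<omega> = (u t \<omega>, z t \<omega>)" for t \<omega>
    define e where "e t \<omega> = infdist (u t \<omega>) S" for t \<omega>
    define w where "w t \<omega> = dist (z t \<omega>) (z_ss (u t \<omega>))" for t \<omega>
    \<comment> \<open>The distance of the new plant state to the old steady state, which contracts only in expectation.\<close>
    define h where "h t \<omega> = dist (f (z t \<omega>) (u t \<omega>) (r t \<omega>)) (z_ss (u t \<omega>))" for t \<omega>
    have init: "u 0 \<omega> = u0" "z 0 \<omega> = z0" and
      next_state: "u (Suc t) \<omega> = u t \<omega> - (\<delta> * \<gamma>) *\<^sub>R dir (u t \<omega>) (z t \<omega>)"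
      "z (Suc t) \<omega> = f (z t \<omega>) (u t \<omega>) (r t \<omega>)" if "\<omega> \<in> space M" for t \<omega>
      using loop that by (auto simp: closed_loop_def dir_def)
    have r_meas: "random_variable borel (r t)" for t
      using indep by (auto simp: indep_vars_def)
    have Y_indep: "random_variable ?N (Y t)"
      "distr M ?N (Y t) \<Otimes>\<^sub>M distr M borel (r t) = distr M (?N \<Otimes>\<^sub>M borel) (\<lambda>\<omega>. (Y t \<omega>, r t \<omega>))" for t
      by (rule driven_recursion_indep_next_input[OF indep G_meas, of "(u0, z0)" Y];
          simp add: Y_def G_def init next_state space_pair_measure)+
    have [measurable]: "random_variable borel (u t)" "random_variable borel (z t)" for t
      using measurable_compose[OF Y_indep(1) measurable_fst] measurable_compose[OF Y_indep(1) measurable_snd]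
      by (simp_all add: Y_def)
    have [measurable]: "(\<lambda>v. infdist v S) \<in> borel_measurable borel"
      by (intro borel_measurable_continuous_onI continuous_on_infdist continuous_on_id)
    have e_meas: "e t \<in> borel_measurable M" for t
      unfolding e_def[abs_def] by measurable
    have w_meas: "w t \<in> borel_measurable M" for t
      unfolding w_def[abs_def] by measurable
    have e_step: "e (Suc t) \<omega> \<le> a * e t \<omega> + b * w t \<omega>"
      and w_step: "w (Suc t) \<omega> \<le> h t \<omega> + (c * e t \<omega> + (d - c_F) * w t \<omega>)" if "\<omega> \<in> space M" for t \<omega>
      using step next_state[OF that] by (simp_all add: e_def w_def h_def)
    have nonneg: "0 \<le> e t \<omega>" "0 \<le> w t \<omega>" for t \<omega>
      by (simp_all add: e_def w_def infdist_nonneg)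
    have h_int: "integrable M (h t)" and h_le: "integral\<^sup>L M (h t) \<le> c_F * integral\<^sup>L M (w t)"
      if "integrable M (w t)" for t
    proof -
      let ?h = "\<lambda>x d. dist (f (snd x) (fst x) d) (z_ss (fst x))"
      let ?w = "\<lambda>x. c_F * dist (snd x) (z_ss (fst x))"
      have "(\<lambda>(x, d). ?h x d) \<in> borel_measurable (?N \<Otimes>\<^sub>M borel)"
        using f_meas' unfolding split_beta' by measurable
      moreover have "?w \<in> borel_measurable ?N"
        by measurable
      moreover have "integrable M (\<lambda>\<omega>. ?w (Y t \<omega>))"
        using that by (simp add: Y_def w_def[abs_def])
      ultimately have "integrable M (\<lambda>\<omega>. ?h (Y t \<omega>) (r t \<omega>))"
        "(\<integral>\<omega>. ?h (Y t \<omega>) (r t \<omega>) \<partial>M) \<le> (\<integral>\<omega>. ?w (Y t \<omega>) \<partial>M)"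
        using expectation_indep_le[OF Y_indep(1) r_meas Y_indep(2), where h="?h" and w="?w"] contr_int contr
        by auto
      then show "integrable M (h t)" "integral\<^sup>L M (h t) \<le> c_F * integral\<^sup>L M (w t)"
        by (simp_all add: Y_def h_def[abs_def] w_def[abs_def])
    qed
    have int: "integrable M (e t) \<and> integrable M (w t)" for t
    proof (induction t)
      case 0
      have "e 0 \<omega> = infdist u0 S" "w 0 \<omega> = dist z0 (z_ss u0)" if "\<omega> \<in> space M" for \<omega>
        using init[OF that] by (simp_all add: e_def w_def)
      then show ?case
        by (simp cong: Bochner_Integration.integrable_cong)
    next
      case (Suc t)
      have "integrable M (\<lambda>\<omega>. a * e t \<omega> + b * w t \<omega>)"
        using Suc by simp
      then have "integrable M (e (Suc t))"
        by (rule Bochner_Integration.integrable_bound[OF _ e_meas])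
          (use e_step nonneg in \<open>auto intro!: AE_I2 intro: order_trans[OF _ abs_ge_self]\<close>)
      moreover have "integrable M (\<lambda>\<omega>. h t \<omega> + (c * e t \<omega> + (d - c_F) * w t \<omega>))"
        using Suc h_int by simp
      then have "integrable M (w (Suc t))"
        by (rule Bochner_Integration.integrable_bound[OF _ w_meas])
          (use w_step nonneg in \<open>auto intro!: AE_I2 intro: order_trans[OF _ abs_ge_self]\<close>)
      ultimately show ?case ..
    qed
    define x y where "x t = integral\<^sup>L M (e t)" and "y t = integral\<^sup>L M (w t)" for t
    have rec: "0 \<le> x t \<and> 0 \<le> y t \<and> x (Suc t) \<le> a * x t + b * y t \<and> y (Suc t) \<le> c * x t + d * y t" for t
    proof (intro conjI)
      show "0 \<le> x t" "0 \<le> y t"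
        using nonneg by (simp_all add: x_def y_def)
      have "x (Suc t) \<le> (\<integral>\<omega>. a * e t \<omega> + b * w t \<omega> \<partial>M)"
        unfolding x_def using int e_step by (intro integral_mono) auto
      then show "x (Suc t) \<le> a * x t + b * y t"
        using int by (simp add: x_def y_def)
      have "y (Suc t) \<le> (\<integral>\<omega>. h t \<omega> + (c * e t \<omega> + (d - c_F) * w t \<omega>) \<partial>M)"
        unfolding y_def using int h_int w_step by (intro integral_mono) auto
      also have "\<dots> = integral\<^sup>L M (h t) + (c * x t + (d - c_F) * y t)"
        using int h_int by (simp add: x_def y_def)
      also have "\<dots> \<le> c_F * y t + (c * x t + (d - c_F) * y t)"
        using h_le int by (simp add: y_def)
      finally show "y (Suc t) \<le> c * x t + d * y t"
        by (simp add: algebra_simps)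
    qed
    have "x 0 = (\<integral>\<omega>. infdist u0 S \<partial>M)" "y 0 = (\<integral>\<omega>. dist z0 (z_ss u0) \<partial>M)"
      unfolding x_def y_def e_def w_def
      by (rule Bochner_Integration.integral_cong; simp add: init)+
    then have "x 0 = infdist u0 S" "y 0 = dist z0 (z_ss u0)"
      by (simp_all add: prob_space)
    then have "norm (x t, y t) \<le> C * \<rho> ^ t * norm (infdist u0 S, dist z0 (z_ss u0))"
      using decay[of x y t, OF rec] by simp
    then show ?thesis
      using int[of t] by (simp add: x_def y_def e_def[abs_def] w_def[abs_def])
  qed
  with C\<rho> show ?thesis by blast
qed

theorem proposition2:
  fixes M :: "'w measure"
    and D :: "(real^'p) set"
    and r :: "nat \<Rightarrow> 'w \<Rightarrow> real^'p"
    and f :: "real^'m \<Rightarrow> real^'n \<Rightarrow> real^'p \<Rightarrow> real^'m"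
    and z_ss :: "real^'n \<Rightarrow> real^'m"
    and l :: "real^'m \<Rightarrow> real"
    and s L c_F L_l L_FIX :: real
  defines "\<Phi> \<equiv> (\<lambda>u. l (z_ss u))"
  assumes "prob_space M" and "complete_measure M"
    and indep: "prob_space.indep_vars M (\<lambda>_. borel) r UNIV"
    and ident: "\<And>t. distr M borel (r t) = distr M borel (r 0)"
    and D_valued: "\<And>t \<omega>. \<omega> \<in> space M \<Longrightarrow> r t \<omega> \<in> D"
    and f_meas: "(\<lambda>(z, u, d). f z u d) \<in> borel_measurable borel"
    and steady: "\<And>u d. d \<in> D \<Longrightarrow> z_ss u = f (z_ss u) u d"
    and l_diff: "\<And>z. l differentiable (at z)"
    and zss_diff: "\<And>u. z_ss differentiable (at u)"
    and \<Phi>_diff: "\<And>u. \<Phi> differentiable (at u)"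
    and "s > 0" and "L > 0" and "L_l > 0" and "L_FIX > 0" and "0 < c_F" and "c_F < 1"
    and \<Phi>_lip: "L-lipschitz_on UNIV (gradient \<Phi>)"
    and l_lip: "L_l-lipschitz_on UNIV (gradient l)"
    and zss_lip: "L_FIX-lipschitz_on UNIV z_ss"
    and contr_int: "\<And>z u t. integrable M (\<lambda>\<omega>. dist (f z u (r t \<omega>)) (z_ss u))"
    and contr: "\<And>z u t. (\<integral>\<omega>. dist (f z u (r t \<omega>)) (z_ss u) \<partial>M) \<le> c_F * dist z (z_ss u)"
  shows
    "(strongly_convex s \<Phi> \<longrightarrow>
       (\<exists>u_star. minimizers \<Phi> = {u_star} \<and>
         (\<forall>\<gamma>\<in>{0<..2 / (s + L)}.
          \<forall>\<delta>\<in>{0<..<min (delta_bar (sqrt (1 - 2 * \<gamma> * s * L / (s + L))) \<gamma> c_F L_FIX L_l L) 1}.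
          \<exists>C \<rho>. C > 0 \<and> 0 < \<rho> \<and> \<rho> < 1 \<and>
            (\<forall>u0 z0 u z. closed_loop M f z_ss l r \<gamma> \<delta> u0 z0 u z \<longrightarrow>
              (\<forall>t. integrable M (\<lambda>\<omega>. dist (u t \<omega>) u_star) \<and>
                   integrable M (\<lambda>\<omega>. dist (z t \<omega>) (z_ss (u t \<omega>))) \<and>
                   norm (\<integral>\<omega>. dist (u t \<omega>) u_star \<partial>M,
                         \<integral>\<omega>. dist (z t \<omega>) (z_ss (u t \<omega>)) \<partial>M)
                     \<le> C * \<rho> ^ t * norm (dist u0 u_star, dist z0 (z_ss u0))))))) \<and>
     (convex_on UNIV \<Phi> \<and> minimizers \<Phi> \<noteq> {} \<and>
      (\<forall>u. \<Phi> u - (INF v. \<Phi> v) \<ge> s / 2 * (infdist u (minimizers \<Phi>))\<^sup>2) \<longrightarrow>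
         (\<forall>\<gamma>\<in>{0<..<2 / L}.
          \<forall>\<delta>\<in>{0<..<min (delta_bar (sqrt (1 - \<gamma> * s\<^sup>2 * (2 - \<gamma> * L) / (4 * L))) \<gamma> c_F L_FIX L_l L) 1}.
          \<exists>C \<rho>. C > 0 \<and> 0 < \<rho> \<and> \<rho> < 1 \<and>
            (\<forall>u0 z0 u z. closed_loop M f z_ss l r \<gamma> \<delta> u0 z0 u z \<longrightarrow>
              (\<forall>t. integrable M (\<lambda>\<omega>. infdist (u t \<omega>) (minimizers \<Phi>)) \<and>
                   integrable M (\<lambda>\<omega>. dist (z t \<omega>) (z_ss (u t \<omega>))) \<and>
                   norm (\<integral>\<omega>. infdist (u t \<omega>) (minimizers \<Phi>) \<partial>M,
                         \<integral>\<omega>. dist (z t \<omega>) (z_ss (u t \<omega>)) \<partial>M)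
                     \<le> C * \<rho> ^ t * norm (infdist u0 (minimizers \<Phi>), dist z0 (z_ss u0))))))"
proof -
  have cont: "continuous_on UNIV \<Phi>"
    using \<Phi>_diff by (simp add: continuous_on_eq_continuous_at differentiable_imp_continuous_within)
  have closed: "closed (minimizers \<Phi>)"
    using cont by (rule closed_minimizers)
  \<comment> \<open>Both parts now only need a contraction factor below 1 for the exact gradient step.\<close>
  note decay = closed_loop_linear_decay[OF \<open>prob_space M\<close> indep f_meas l_diff zss_diff
      \<open>L > 0\<close> \<open>L_l > 0\<close> \<open>L_FIX > 0\<close> \<open>0 < c_F\<close> \<open>c_F < 1\<close> \<Phi>_lip[unfolded \<Phi>_def] l_lip zss_lip
      contr_int contr closed _ gradient_minimizer_eq_0[OF \<Phi>_diff \<Phi>_lip \<open>L > 0\<close>, unfolded \<Phi>_def],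
      folded \<Phi>_def]
  show ?thesis
  proof (intro conjI impI)
    assume sc: "strongly_convex s \<Phi>"
    obtain u_star where u_star: "minimizers \<Phi> = {u_star}"
      using strongly_convex_unique_minimizer[OF sc \<open>s > 0\<close> \<Phi>_diff] by blast
    have "\<exists>C \<rho>. C > 0 \<and> 0 < \<rho> \<and> \<rho> < 1 \<and>
        (\<forall>u0 z0 u z. closed_loop M f z_ss l r \<gamma> \<delta> u0 z0 u z \<longrightarrow>
          (\<forall>t. integrable M (\<lambda>\<omega>. infdist (u t \<omega>) (minimizers \<Phi>)) \<and>
               integrable M (\<lambda>\<omega>. dist (z t \<omega>) (z_ss (u t \<omega>))) \<and>
               norm (\<integral>\<omega>. infdist (u t \<omega>) (minimizers \<Phi>) \<partial>M, \<integral>\<omega>. dist (z t \<omega>) (z_ss (u t \<omega>)) \<partial>M)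
                 \<le> C * \<rho> ^ t * norm (infdist u0 (minimizers \<Phi>), dist z0 (z_ss u0))))"
      if \<gamma>: "\<gamma> \<in> {0<..2 / (s + L)}"
        and \<delta>: "\<delta> \<in> {0<..<min (delta_bar (sqrt (1 - 2 * \<gamma> * s * L / (s + L))) \<gamma> c_F L_FIX L_l L) 1}"
      for \<gamma> \<delta>
    proof (rule decay)
      show "norm (u - \<gamma> *\<^sub>R gradient \<Phi> u - y) \<le> sqrt (1 - 2 * \<gamma> * s * L / (s + L)) * norm (u - y)"
        if "y \<in> minimizers \<Phi>" for u y
        using \<gamma> that \<open>s > 0\<close> \<open>L > 0\<close>
        by (intro gradient_step_contraction_strongly_convex[OF sc \<Phi>_diff \<Phi>_lip]) auto
      show "sqrt (1 - 2 * \<gamma> * s * L / (s + L)) < 1"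
        using \<gamma> \<open>s > 0\<close> \<open>L > 0\<close> by (simp add: real_less_rsqrt zero_less_divide_iff)
    qed (use \<gamma> \<delta> u_star in auto)
    then show "\<exists>u_star. minimizers \<Phi> = {u_star} \<and>
         (\<forall>\<gamma>\<in>{0<..2 / (s + L)}.
          \<forall>\<delta>\<in>{0<..<min (delta_bar (sqrt (1 - 2 * \<gamma> * s * L / (s + L))) \<gamma> c_F L_FIX L_l L) 1}.
          \<exists>C \<rho>. C > 0 \<and> 0 < \<rho> \<and> \<rho> < 1 \<and>
            (\<forall>u0 z0 u z. closed_loop M f z_ss l r \<gamma> \<delta> u0 z0 u z \<longrightarrow>
              (\<forall>t. integrable M (\<lambda>\<omega>. dist (u t \<omega>) u_star) \<and>
                   integrable M (\<lambda>\<omega>. dist (z t \<omega>) (z_ss (u t \<omega>))) \<and>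
                   norm (\<integral>\<omega>. dist (u t \<omega>) u_star \<partial>M,
                         \<integral>\<omega>. dist (z t \<omega>) (z_ss (u t \<omega>)) \<partial>M)
                     \<le> C * \<rho> ^ t * norm (dist u0 u_star, dist z0 (z_ss u0)))))"
      using u_star by (intro exI[of _ u_star] conjI ballI) simp_all
  next
    assume *: "convex_on UNIV \<Phi> \<and> minimizers \<Phi> \<noteq> {} \<and>
      (\<forall>u. \<Phi> u - (INF v. \<Phi> v) \<ge> s / 2 * (infdist u (minimizers \<Phi>))\<^sup>2)"
    have inf: "(INF v. \<Phi> v) = \<Phi> y" if "y \<in> minimizers \<Phi>" for y
      using that by (intro cInf_eq_minimum) (auto simp: minimizers_def)
    show "\<forall>\<gamma>\<in>{0<..<2 / L}.
          \<forall>\<delta>\<in>{0<..<min (delta_bar (sqrt (1 - \<gamma> * s\<^sup>2 * (2 - \<gamma> * L) / (4 * L))) \<gamma> c_F L_FIX L_l L) 1}.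
          \<exists>C \<rho>. C > 0 \<and> 0 < \<rho> \<and> \<rho> < 1 \<and>
            (\<forall>u0 z0 u z. closed_loop M f z_ss l r \<gamma> \<delta> u0 z0 u z \<longrightarrow>
              (\<forall>t. integrable M (\<lambda>\<omega>. infdist (u t \<omega>) (minimizers \<Phi>)) \<and>
                   integrable M (\<lambda>\<omega>. dist (z t \<omega>) (z_ss (u t \<omega>))) \<and>
                   norm (\<integral>\<omega>. infdist (u t \<omega>) (minimizers \<Phi>) \<partial>M,
                         \<integral>\<omega>. dist (z t \<omega>) (z_ss (u t \<omega>)) \<partial>M)
                     \<le> C * \<rho> ^ t * norm (infdist u0 (minimizers \<Phi>), dist z0 (z_ss u0))))"
    proof (intro ballI)
      fix \<gamma> \<delta>
      assume \<gamma>: "\<gamma> \<in> {0<..<2 / L}"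
        and \<delta>: "\<delta> \<in> {0<..<min (delta_bar (sqrt (1 - \<gamma> * s\<^sup>2 * (2 - \<gamma> * L) / (4 * L))) \<gamma> c_F L_FIX L_l L) 1}"
      have "0 < \<gamma> * s\<^sup>2 * (2 - \<gamma> * L) / (4 * L)"
        using \<gamma> \<open>s > 0\<close> \<open>L > 0\<close> by (simp add: less_divide_eq)
      then have q: "sqrt (1 - \<gamma> * s\<^sup>2 * (2 - \<gamma> * L) / (4 * L)) < 1"
        by (simp add: real_less_rsqrt)
      have contraction: "norm (u - \<gamma> *\<^sub>R gradient \<Phi> u - y)
          \<le> sqrt (1 - \<gamma> * s\<^sup>2 * (2 - \<gamma> * L) / (4 * L)) * norm (u - y)"
        if y: "y \<in> minimizers \<Phi>" and near: "infdist u (minimizers \<Phi>) = dist u y" for u y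
      proof (rule gradient_step_contraction_quadratic_growth[OF _ \<Phi>_diff \<Phi>_lip \<open>s > 0\<close> \<open>L > 0\<close> y])
        show "s / 2 * (norm (u - y))\<^sup>2 \<le> \<Phi> u - \<Phi> y"
          using conjunct2[OF conjunct2[OF *], rule_format, of u] unfolding inf[OF y] near dist_norm .
      qed (use * \<gamma> in auto)
      show "\<exists>C \<rho>. C > 0 \<and> 0 < \<rho> \<and> \<rho> < 1 \<and>
            (\<forall>u0 z0 u z. closed_loop M f z_ss l r \<gamma> \<delta> u0 z0 u z \<longrightarrow>
              (\<forall>t. integrable M (\<lambda>\<omega>. infdist (u t \<omega>) (minimizers \<Phi>)) \<and>
                   integrable M (\<lambda>\<omega>. dist (z t \<omega>) (z_ss (u t \<omega>))) \<and>
                   norm (\<integral>\<omega>. infdist (u t \<omega>) (minimizers \<Phi>) \<partial>M,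
                         \<integral>\<omega>. dist (z t \<omega>) (z_ss (u t \<omega>)) \<partial>M)
                     \<le> C * \<rho> ^ t * norm (infdist u0 (minimizers \<Phi>), dist z0 (z_ss u0))))"
        by (rule decay[OF _ _ contraction q]) (use * \<gamma> \<delta> in auto)
    qed
  qed
qed

end
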